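(* Let $\mathsf{R}'_{\mathrm{PWK}}$ be the single-conclusion Hilbert-style system over the language $L$ given below, and let $\vdash_{\mathrm{PWK}}$ be Paraconsistent Weak Kleene logic. Then $\vdash_{\mathsf{R}'_{\mathrm{PWK}}} \;=\; \vdash_{\mathrm{PWK}}$, i.e. for all $\Gamma\cup\{\varphi\}\subseteq L$, $\Gamma\vdash_{\mathsf{R}'_{\mathrm{PWK}}}\varphi$ iff $\Gamma\vdash_{\mathrm{PWK}}\varphi$.
   Context: $L$ is the set of formulas built from a countably infinite set of propositional variables using binary connectives $\land,\lor$ and unary $\neg$. Let $\mathbf{A}$ be the algebra on $\{f,u,t\}$ in which each connective, applied to arguments all in $\{f,t\}$, returns the classical Boolean value (with $f$ = false, $t$ = true), and returns $u$ whenever at least one argument is $u$. A valuation is a homomorphism $v$ from the formula algebra into $\mathbf{A}$. $\Gamma\vdash_{\mathrm{PWK}}\varphi$ iff there is no valuation $v$ with $v[\Gamma]\subseteq\{u,t\}$ and $v(\varphi)=f$. A single-conclusion (Set-Fmla) Hilbert system is given by rule schemas $\gamma_1,\dots,\gamma_m/\varphi$ ($m\ge 0$); their instances are obtained by applying arbitrary substitutions (endomorphisms of the formula algebra). $\Gamma\vdash_{\mathsf R}\varphi$ iff there is a finite sequence of formulas ending in $\varphi$ each member of which is in $\Gamma$ or is the conclusion of a rule instance whose premises all occur earlier in the sequence. The rule schemas of $\mathsf{R}'_{\mathrm{PWK}}$ (with $p,q,r$ distinct variables) are: $\varnothing/p\lor\neg p$; $p\lor r/\neg\neg p\lor r$;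 $\neg\neg p\lor r/p\lor r$; $p\lor r,\,q\lor r/(p\land q)\lor r$; $(p\land q)\lor r/(p\lor q)\lor r$; $(p\land q)\lor r/(p\lor\neg q)\lor r$; $(p\land q)\lor r/(\neg p\lor q)\lor r$; $\neg(p\land q)\lor r/(\neg p\lor\neg q)\lor r$; $p\lor r,\,\neg p\lor r/(p\land q)\lor r$; $\neg p\lor r/\neg(p\land q)\lor r$; $q\lor r,\,\neg q\lor r/(p\land q)\lor r$; $\neg q\lor r/\neg(p\land q)\lor r$; $p\lor r/(p\lor q)\lor r$; $q\lor r/(p\lor q)\lor r$; $\neg(p\lor q)\lor r/(p\lor\neg q)\lor r$; $\neg(p\lor q)\lor r/(\neg p\lor q)\lor r$; $\neg(p\lor q)\lor r/(\neg p\lor\neg q)\lor r$; $p\lor r,\,\neg p\lor r/\neg(p\lor q)\lor r$; $q\lor r,\,\neg q\lor r/\neg(p\lor q)\lor r$; $p\lor p/p$; $p/p\lor q$; $p\lor q/q\lor p$; $p\lor(q\lor r)/(p\lor q)\lor r$. *)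

theory Defs
  imports Main
begin

datatype fm =
    Var nat
  | Conj fm fm  (infixr \<open>\<^bold>\<and>\<close> 75)
  | Disj fm fm  (infixr \<open>\<^bold>\<or>\<close> 70)
  | Neg fm      (\<open>\<^bold>\<not> _\<close> [80] 80)

datatype tv = F | U | T

definition of_bool_tv :: "bool \<Rightarrow> tv" where
  "of_bool_tv b = (if b then T else F)"

definition conj_tv :: "tv \<Rightarrow> tv \<Rightarrow> tv" where
  "conj_tv x y = (if x = U \<or> y = U then U else of_bool_tv (x = T \<and> y = T))"

definition disj_tv :: "tv \<Rightarrow> tv \<Rightarrow> tv" where
  "disj_tv x y = (if x = U \<or> y = U then U else of_bool_tv (x = T \<or> y = T))"

definition neg_tv :: "tv \<Rightarrow> tv" where
  "neg_tv x = (if x = U then U else of_bool_tv (\<not> x = T))"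

definition valuation :: "(fm \<Rightarrow> tv) \<Rightarrow> bool" where
  "valuation v \<longleftrightarrow>
     (\<forall>a b. v (a \<^bold>\<and> b) = conj_tv (v a) (v b)) \<and>
     (\<forall>a b. v (a \<^bold>\<or> b) = disj_tv (v a) (v b)) \<and>
     (\<forall>a. v (\<^bold>\<not> a) = neg_tv (v a))"

definition pwk :: "fm set \<Rightarrow> fm \<Rightarrow> bool"  (infix \<open>\<turnstile>\<^sub>P\<^sub>W\<^sub>K\<close> 50) where
  "\<Gamma> \<turnstile>\<^sub>P\<^sub>W\<^sub>K \<phi> \<longleftrightarrow> (\<nexists>v. valuation v \<and> v ` \<Gamma> \<subseteq> {U, T} \<and> v \<phi> = F)"

definition substitution :: "(fm \<Rightarrow> fm) \<Rightarrow> bool" where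
  "substitution s \<longleftrightarrow>
     (\<forall>a b. s (a \<^bold>\<and> b) = s a \<^bold>\<and> s b) \<and>
     (\<forall>a b. s (a \<^bold>\<or> b) = s a \<^bold>\<or> s b) \<and>
     (\<forall>a. s (\<^bold>\<not> a) = \<^bold>\<not> (s a))"

type_synonym rule = "fm list \<times> fm"

definition rule_instance :: "rule set \<Rightarrow> fm set \<Rightarrow> fm \<Rightarrow> bool" where
  "rule_instance R \<Delta> \<psi> \<longleftrightarrow>
     (\<exists>(\<gamma>s, \<chi>) \<in> R. \<exists>s. substitution s \<and> \<Delta> = s ` set \<gamma>s \<and> \<psi> = s \<chi>)"

definition derivation :: "rule set \<Rightarrow> fm set \<Rightarrow> fm list \<Rightarrow> bool" where
  "derivation R \<Gamma> xs \<longleftrightarrow>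
     (\<forall>i < length xs. xs ! i \<in> \<Gamma> \<or>
        (\<exists>\<Delta>. rule_instance R \<Delta> (xs ! i) \<and> \<Delta> \<subseteq> set (take i xs)))"

definition derives :: "rule set \<Rightarrow> fm set \<Rightarrow> fm \<Rightarrow> bool" where
  "derives R \<Gamma> \<phi> \<longleftrightarrow> (\<exists>xs. xs \<noteq> [] \<and> last xs = \<phi> \<and> derivation R \<Gamma> xs)"

definition R'_PWK :: "rule set" where
  "R'_PWK = (let p = Var 0; q = Var 1; r = Var 2 in
    {([], p \<^bold>\<or> \<^bold>\<not> p),
     ([p \<^bold>\<or> r], \<^bold>\<not> \<^bold>\<not> p \<^bold>\<or> r),
     ([\<^bold>\<not> \<^bold>\<not> p \<^bold>\<or> r], p \<^bold>\<or> r),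
     ([p \<^bold>\<or> r, q \<^bold>\<or> r], (p \<^bold>\<and> q) \<^bold>\<or> r),
     ([(p \<^bold>\<and> q) \<^bold>\<or> r], (p \<^bold>\<or> q) \<^bold>\<or> r),
     ([(p \<^bold>\<and> q) \<^bold>\<or> r], (p \<^bold>\<or> \<^bold>\<not> q) \<^bold>\<or> r),
     ([(p \<^bold>\<and> q) \<^bold>\<or> r], (\<^bold>\<not> p \<^bold>\<or> q) \<^bold>\<or> r),
     ([\<^bold>\<not> (p \<^bold>\<and> q) \<^bold>\<or> r], (\<^bold>\<not> p \<^bold>\<or> \<^bold>\<not> q) \<^bold>\<or> r),
     ([p \<^bold>\<or> r, \<^bold>\<not> p \<^bold>\<or> r], (p \<^bold>\<and> q) \<^bold>\<or> r),
     ([\<^bold>\<not> p \<^bold>\<or> r], \<^bold>\<not> (p \<^bold>\<and> q) \<^bold>\<or> r),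
     ([q \<^bold>\<or> r, \<^bold>\<not> q \<^bold>\<or> r], (p \<^bold>\<and> q) \<^bold>\<or> r),
     ([\<^bold>\<not> q \<^bold>\<or> r], \<^bold>\<not> (p \<^bold>\<and> q) \<^bold>\<or> r),
     ([p \<^bold>\<or> r], (p \<^bold>\<or> q) \<^bold>\<or> r),
     ([q \<^bold>\<or> r], (p \<^bold>\<or> q) \<^bold>\<or> r),
     ([\<^bold>\<not> (p \<^bold>\<or> q) \<^bold>\<or> r], (p \<^bold>\<or> \<^bold>\<not> q) \<^bold>\<or> r),
     ([\<^bold>\<not> (p \<^bold>\<or> q) \<^bold>\<or> r], (\<^bold>\<not> p \<^bold>\<or> q) \<^bold>\<or> r),
     ([\<^bold>\<not> (p \<^bold>\<or> q) \<^bold>\<or> r], (\<^bold>\<not> p \<^bold>\<or> \<^bold>\<not> q) \<^bold>\<or> r),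
     ([p \<^bold>\<or> r, \<^bold>\<not> p \<^bold>\<or> r], \<^bold>\<not> (p \<^bold>\<or> q) \<^bold>\<or> r),
     ([q \<^bold>\<or> r, \<^bold>\<not> q \<^bold>\<or> r], \<^bold>\<not> (p \<^bold>\<or> q) \<^bold>\<or> r),
     ([p \<^bold>\<or> p], p),
     ([p], p \<^bold>\<or> q),
     ([p \<^bold>\<or> q], q \<^bold>\<or> p),
     ([p \<^bold>\<or> (q \<^bold>\<or> r)], (p \<^bold>\<or> q) \<^bold>\<or> r)})"

end

theory Submission
  imports Defs
begin

text \<open>Soundness holds rule by rule. For completeness, every rule remains derivable inside a
  disjunctive context, which yields proof by cases from a disjunction. Hence a theory that is
  maximal among those not proving \<open>\<phi>\<close> is prime, and it induces a countermodel: a formula gets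
  the value \<open>U\<close> if the theory contains both it and its negation, \<open>T\<close> if it contains only the
  formula, and \<open>F\<close> otherwise.\<close>

section \<open>The calculus as an inductive predicate\<close>

text \<open>Arbitrary formulas stand in for the three schema variables, so instances need no
  explicit substitution and rule induction replaces reasoning about positions in a list.\<close>

inductive hilbert :: "fm set \<Rightarrow> fm \<Rightarrow> bool"  (infix \<open>\<turnstile>\<^sub>H\<close> 50) for \<Gamma> where
  premise: "a \<in> \<Gamma> \<Longrightarrow> \<Gamma> \<turnstile>\<^sub>H a"
| excluded_middle: "\<Gamma> \<turnstile>\<^sub>H a \<^bold>\<or> \<^bold>\<not> a"
| dneg_intro: "\<Gamma> \<turnstile>\<^sub>H a \<^bold>\<or> c \<Longrightarrow> \<Gamma> \<turnstile>\<^sub>H \<^bold>\<not> \<^bold>\<not> a \<^bold>\<or> c"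
| dneg_elim: "\<Gamma> \<turnstile>\<^sub>H \<^bold>\<not> \<^bold>\<not> a \<^bold>\<or> c \<Longrightarrow> \<Gamma> \<turnstile>\<^sub>H a \<^bold>\<or> c"
| conj_intro: "\<Gamma> \<turnstile>\<^sub>H a \<^bold>\<or> c \<Longrightarrow> \<Gamma> \<turnstile>\<^sub>H b \<^bold>\<or> c \<Longrightarrow> \<Gamma> \<turnstile>\<^sub>H (a \<^bold>\<and> b) \<^bold>\<or> c"
| conj_elim: "\<Gamma> \<turnstile>\<^sub>H (a \<^bold>\<and> b) \<^bold>\<or> c \<Longrightarrow> \<Gamma> \<turnstile>\<^sub>H (a \<^bold>\<or> b) \<^bold>\<or> c"
| conj_elim_right_neg: "\<Gamma> \<turnstile>\<^sub>H (a \<^bold>\<and> b) \<^bold>\<or> c \<Longrightarrow> \<Gamma> \<turnstile>\<^sub>H (a \<^bold>\<or> \<^bold>\<not> b) \<^bold>\<or> c"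
| conj_elim_left_neg: "\<Gamma> \<turnstile>\<^sub>H (a \<^bold>\<and> b) \<^bold>\<or> c \<Longrightarrow> \<Gamma> \<turnstile>\<^sub>H (\<^bold>\<not> a \<^bold>\<or> b) \<^bold>\<or> c"
| neg_conj_elim: "\<Gamma> \<turnstile>\<^sub>H \<^bold>\<not> (a \<^bold>\<and> b) \<^bold>\<or> c \<Longrightarrow> \<Gamma> \<turnstile>\<^sub>H (\<^bold>\<not> a \<^bold>\<or> \<^bold>\<not> b) \<^bold>\<or> c"
| conj_intro_left_glut: "\<Gamma> \<turnstile>\<^sub>H a \<^bold>\<or> c \<Longrightarrow> \<Gamma> \<turnstile>\<^sub>H \<^bold>\<not> a \<^bold>\<or> c \<Longrightarrow> \<Gamma> \<turnstile>\<^sub>H (a \<^bold>\<and> b) \<^bold>\<or> c"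
| neg_conj_intro_left: "\<Gamma> \<turnstile>\<^sub>H \<^bold>\<not> a \<^bold>\<or> c \<Longrightarrow> \<Gamma> \<turnstile>\<^sub>H \<^bold>\<not> (a \<^bold>\<and> b) \<^bold>\<or> c"
| conj_intro_right_glut: "\<Gamma> \<turnstile>\<^sub>H b \<^bold>\<or> c \<Longrightarrow> \<Gamma> \<turnstile>\<^sub>H \<^bold>\<not> b \<^bold>\<or> c \<Longrightarrow> \<Gamma> \<turnstile>\<^sub>H (a \<^bold>\<and> b) \<^bold>\<or> c"
| neg_conj_intro_right: "\<Gamma> \<turnstile>\<^sub>H \<^bold>\<not> b \<^bold>\<or> c \<Longrightarrow> \<Gamma> \<turnstile>\<^sub>H \<^bold>\<not> (a \<^bold>\<and> b) \<^bold>\<or> c"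
| disj_intro_left: "\<Gamma> \<turnstile>\<^sub>H a \<^bold>\<or> c \<Longrightarrow> \<Gamma> \<turnstile>\<^sub>H (a \<^bold>\<or> b) \<^bold>\<or> c"
| disj_intro_right: "\<Gamma> \<turnstile>\<^sub>H b \<^bold>\<or> c \<Longrightarrow> \<Gamma> \<turnstile>\<^sub>H (a \<^bold>\<or> b) \<^bold>\<or> c"
| neg_disj_elim_right_neg: "\<Gamma> \<turnstile>\<^sub>H \<^bold>\<not> (a \<^bold>\<or> b) \<^bold>\<or> c \<Longrightarrow> \<Gamma> \<turnstile>\<^sub>H (a \<^bold>\<or> \<^bold>\<not> b) \<^bold>\<or> c"
| neg_disj_elim_left_neg: "\<Gamma> \<turnstile>\<^sub>H \<^bold>\<not> (a \<^bold>\<or> b) \<^bold>\<or> c \<Longrightarrow> \<Gamma> \<turnstile>\<^sub>H (\<^bold>\<not> a \<^bold>\<or> b) \<^bold>\<or> c"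
| neg_disj_elim: "\<Gamma> \<turnstile>\<^sub>H \<^bold>\<not> (a \<^bold>\<or> b) \<^bold>\<or> c \<Longrightarrow> \<Gamma> \<turnstile>\<^sub>H (\<^bold>\<not> a \<^bold>\<or> \<^bold>\<not> b) \<^bold>\<or> c"
| neg_disj_intro_left_glut: "\<Gamma> \<turnstile>\<^sub>H a \<^bold>\<or> c \<Longrightarrow> \<Gamma> \<turnstile>\<^sub>H \<^bold>\<not> a \<^bold>\<or> c \<Longrightarrow> \<Gamma> \<turnstile>\<^sub>H \<^bold>\<not> (a \<^bold>\<or> b) \<^bold>\<or> c"
| neg_disj_intro_right_glut: "\<Gamma> \<turnstile>\<^sub>H b \<^bold>\<or> c \<Longrightarrow> \<Gamma> \<turnstile>\<^sub>H \<^bold>\<not> b \<^bold>\<or> c \<Longrightarrow> \<Gamma> \<turnstile>\<^sub>H \<^bold>\<not> (a \<^bold>\<or> b) \<^bold>\<or> c"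
| contraction: "\<Gamma> \<turnstile>\<^sub>H a \<^bold>\<or> a \<Longrightarrow> \<Gamma> \<turnstile>\<^sub>H a"
| weakening: "\<Gamma> \<turnstile>\<^sub>H a \<Longrightarrow> \<Gamma> \<turnstile>\<^sub>H a \<^bold>\<or> b"
| commute: "\<Gamma> \<turnstile>\<^sub>H a \<^bold>\<or> b \<Longrightarrow> \<Gamma> \<turnstile>\<^sub>H b \<^bold>\<or> a"
| assoc: "\<Gamma> \<turnstile>\<^sub>H a \<^bold>\<or> (b \<^bold>\<or> c) \<Longrightarrow> \<Gamma> \<turnstile>\<^sub>H (a \<^bold>\<or> b) \<^bold>\<or> c"

text \<open>The endomorphism extending an assignment of the variables; it supplies the witness that
  \<open>rule_instance\<close> asks for.\<close>

fun subst :: "(nat \<Rightarrow> fm) \<Rightarrow> fm \<Rightarrow> fm" where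
  "subst \<sigma> (Var n) = \<sigma> n"
| "subst \<sigma> (a \<^bold>\<and> b) = subst \<sigma> a \<^bold>\<and> subst \<sigma> b"
| "subst \<sigma> (a \<^bold>\<or> b) = subst \<sigma> a \<^bold>\<or> subst \<sigma> b"
| "subst \<sigma> (\<^bold>\<not> a) = \<^bold>\<not> subst \<sigma> a"

lemma substitution_subst: "substitution (subst \<sigma>)"
  by (simp add: substitution_def)

lemma derivation_append:
  assumes "derivation R \<Gamma> xs" "derivation R \<Gamma> ys"
  shows "derivation R \<Gamma> (xs @ ys)"
  unfolding derivation_def
proof (intro allI impI)
  fix i assume i: "i < length (xs @ ys)"
  show "(xs @ ys) ! i \<in> \<Gamma> \<or>
    (\<exists>\<Delta>. rule_instance R \<Delta> ((xs @ ys) ! i) \<and> \<Delta> \<subseteq> set (take i (xs @ ys)))"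
  proof (cases "i < length xs")
    case True
    then show ?thesis using assms(1) by (simp add: derivation_def nth_append)
  next
    case False
    then have "i - length xs < length ys" using i by simp
    with assms(2) have "ys ! (i - length xs) \<in> \<Gamma> \<or>
      (\<exists>\<Delta>. rule_instance R \<Delta> (ys ! (i - length xs)) \<and> \<Delta> \<subseteq> set (take (i - length xs) ys))"
      unfolding derivation_def by blast
    with False show ?thesis by (auto simp: nth_append)
  qed
qed

text \<open>Concatenating the separate derivations puts all premises of a rule into one list, to
  which its conclusion can then be appended.\<close>

lemma derives_list_imp_derivation:
  assumes "\<And>a. a \<in> set as \<Longrightarrow> derives R \<Gamma> a"
  shows "\<exists>xs. derivation R \<Gamma> xs \<and> set as \<subseteq> set xs"
  using assms
proof (induction as)
  case Nil
  have "derivation R \<Gamma> []" by (simp add: derivation_def)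
  then show ?case by auto
next
  case (Cons a as)
  then obtain xs where xs: "derivation R \<Gamma> xs" "set as \<subseteq> set xs" by auto
  from Cons.prems[of a] obtain ys where "ys \<noteq> []" "last ys = a" "derivation R \<Gamma> ys"
    by (auto simp: derives_def)
  with xs derivation_append[of R \<Gamma> ys xs] show ?case
    by (intro exI[of _ "ys @ xs"]) (auto dest: last_in_set)
qed

lemma derives_premise: "a \<in> \<Gamma> \<Longrightarrow> derives R \<Gamma> a"
  unfolding derives_def by (rule exI[of _ "[a]"]) (simp add: derivation_def)

lemma derives_rule:
  assumes "(\<gamma>s, \<chi>) \<in> R" "\<And>\<gamma>. \<gamma> \<in> set \<gamma>s \<Longrightarrow> derives R \<Gamma> (subst \<sigma> \<gamma>)"
  shows "derives R \<Gamma> (subst \<sigma> \<chi>)"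
proof -
  obtain xs where xs: "derivation R \<Gamma> xs" "set (map (subst \<sigma>) \<gamma>s) \<subseteq> set xs"
    using derives_list_imp_derivation[of "map (subst \<sigma>) \<gamma>s" R \<Gamma>] assms(2) by auto
  have "rule_instance R (subst \<sigma> ` set \<gamma>s) (subst \<sigma> \<chi>)"
    using assms(1) substitution_subst unfolding rule_instance_def by blast
  with xs have "derivation R \<Gamma> (xs @ [subst \<sigma> \<chi>])"
    unfolding derivation_def by (auto simp: nth_append less_Suc_eq)
  then show ?thesis unfolding derives_def by (intro exI[of _ "xs @ [subst \<sigma> \<chi>]"]) simp
qed

lemma hilbert_imp_derives:
  assumes "\<Gamma> \<turnstile>\<^sub>H \<phi>"
  shows "derives R'_PWK \<Gamma> \<phi>"
proof -
  \<comment> \<open>\<open>P\<close> hides this occurrence of \<open>R'_PWK\<close>, so that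
    unfolding the rule set below leaves derivability itself untouched.\<close>
  define P where "P = derives R'_PWK \<Gamma>"
  \<comment> \<open>\<open>Var 0\<close> and \<open>Var 1\<close> are sent to \<open>a\<close> and
    \<open>b\<close>, every other variable, in particular \<open>Var 2\<close>, to \<open>c\<close>.
    The existential form leaves the choice of the schema to the simplifier once
    \<open>R'_PWK_def\<close> has listed them.\<close>
  have closed: "P \<psi>"
    if "\<exists>(\<gamma>s, \<chi>) \<in> R'_PWK. \<exists>a b c. \<psi> = subst ((\<lambda>_. c)(0 := a, 1 := b)) \<chi> \<and>
      (\<forall>\<gamma> \<in> set \<gamma>s. P (subst ((\<lambda>_. c)(0 := a, 1 := b)) \<gamma>))" for \<psi>
    using that derives_rule unfolding P_def by blast
  from assms have "P \<phi>"
  proof (induction rule: hilbert.induct)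
    case (premise a) then show ?case unfolding P_def by (rule derives_premise)
  qed (rule closed, simp add: R'_PWK_def Let_def)+
  then show ?thesis unfolding P_def .
qed

lemma rule_instance_imp_hilbert:
  assumes "rule_instance R'_PWK \<Delta> \<psi>" "\<And>\<delta>. \<delta> \<in> \<Delta> \<Longrightarrow> \<Gamma> \<turnstile>\<^sub>H \<delta>"
  shows "\<Gamma> \<turnstile>\<^sub>H \<psi>"
proof -
  obtain \<gamma>s \<chi> s where s: "(\<gamma>s, \<chi>) \<in> R'_PWK" "substitution s" "\<Delta> = s ` set \<gamma>s" "\<psi> = s \<chi>"
    using assms(1) unfolding rule_instance_def by blast
  then have prem: "\<forall>\<gamma> \<in> set \<gamma>s. \<Gamma> \<turnstile>\<^sub>H s \<gamma>" using assms(2) by blast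
  \<comment> \<open>Pushing \<open>s\<close> down to the variables gives each instance the shape of
    an introduction rule of \<open>hilbert\<close>.\<close>
  have [simp]: "s (a \<^bold>\<and> b) = s a \<^bold>\<and> s b" "s (a \<^bold>\<or> b) = s a \<^bold>\<or> s b" "s (\<^bold>\<not> a) = \<^bold>\<not> s a" for a b
    using s(2) by (simp_all add: substitution_def)
  show ?thesis using s(1) prem unfolding s(4) R'_PWK_def Let_def insert_iff empty_iff
    by (elim disjE) (auto intro: hilbert.intros)
qed

lemma derives_imp_hilbert:
  assumes "derives R'_PWK \<Gamma> \<phi>"
  shows "\<Gamma> \<turnstile>\<^sub>H \<phi>"
proof -
  obtain xs where xs: "xs \<noteq> []" "last xs = \<phi>" "derivation R'_PWK \<Gamma> xs"
    using assms unfolding derives_def by blast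
  have "i < length xs \<Longrightarrow> \<Gamma> \<turnstile>\<^sub>H xs ! i" for i
  proof (induction i rule: less_induct)
    case (less i)
    have earlier: "\<Gamma> \<turnstile>\<^sub>H \<delta>" if "\<delta> \<in> set (take i xs)" for \<delta>
      using that less by (auto simp: in_set_conv_nth)
    consider "xs ! i \<in> \<Gamma>"
      | \<Delta> where "rule_instance R'_PWK \<Delta> (xs ! i)" "\<Delta> \<subseteq> set (take i xs)"
      using xs(3) less.prems unfolding derivation_def by blast
    then show ?case
      by cases (use earlier in \<open>auto intro: premise rule_instance_imp_hilbert\<close>)
  qed
  from this[of "length xs - 1"] xs(1,2) show ?thesis by (simp add: last_conv_nth)
qed

lemma derives_iff_hilbert: "derives R'_PWK \<Gamma> \<phi> \<longleftrightarrow> \<Gamma> \<turnstile>\<^sub>H \<phi>"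
  using derives_imp_hilbert hilbert_imp_derives by blast

section \<open>Soundness\<close>

lemma hilbert_sound:
  assumes "\<Gamma> \<turnstile>\<^sub>H \<phi>"
  shows "\<Gamma> \<turnstile>\<^sub>P\<^sub>W\<^sub>K \<phi>"
proof -
  have "v \<phi> \<noteq> F" if v: "valuation v" "v ` \<Gamma> \<subseteq> {U, T}" for v
  proof -
    \<comment> \<open>Each rule must preserve being different from \<open>F\<close>. The conditions
      for \<open>T\<close> are needed as well, because negation exchanges \<open>F\<close> and
      \<open>T\<close>.\<close>
    have [simp]: "v (a \<^bold>\<and> b) = F \<longleftrightarrow> v a = F \<and> v b \<in> {F, T} \<or> v a = T \<and> v b = F"
      "v (a \<^bold>\<or> b) = F \<longleftrightarrow> v a = F \<and> v b = F"
      "v (\<^bold>\<not> a) = F \<longleftrightarrow> v a = T"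
      "v (a \<^bold>\<and> b) = T \<longleftrightarrow> v a = T \<and> v b = T"
      "v (a \<^bold>\<or> b) = T \<longleftrightarrow> v a = T \<and> v b \<in> {F, T} \<or> v a = F \<and> v b = T"
      "v (\<^bold>\<not> a) = T \<longleftrightarrow> v a = F" for a b
      using v(1) by (cases "v a"; cases "v b";
        simp add: valuation_def conj_tv_def disj_tv_def neg_tv_def of_bool_tv_def)+
    from assms show ?thesis
      by (induction rule: hilbert.induct) (use v(2) in \<open>auto simp: image_subset_iff\<close>)
  qed
  then show ?thesis unfolding pwk_def by blast
qed

section \<open>Cut, monotonicity and compactness\<close>

lemma hilbert_cut:
  assumes "\<Delta> \<turnstile>\<^sub>H \<phi>" "\<And>a. a \<in> \<Delta> \<Longrightarrow> \<Gamma> \<turnstile>\<^sub>H a"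
  shows "\<Gamma> \<turnstile>\<^sub>H \<phi>"
  using assms by (induction rule: hilbert.induct) (auto intro: hilbert.intros)

lemma hilbert_mono: "\<Delta> \<turnstile>\<^sub>H \<phi> \<Longrightarrow> \<Delta> \<subseteq> \<Gamma> \<Longrightarrow> \<Gamma> \<turnstile>\<^sub>H \<phi>"
  by (blast intro: hilbert_cut premise)

text \<open>Only rules with two premises need care: the finite sets obtained for the premises are
  merged into their union, which proves both by monotonicity.\<close>

lemma hilbert_compact:
  assumes "\<Gamma> \<turnstile>\<^sub>H \<phi>"
  shows "\<exists>\<Delta>. finite \<Delta> \<and> \<Delta> \<subseteq> \<Gamma> \<and> \<Delta> \<turnstile>\<^sub>H \<phi>"
proof -
  have two: "\<exists>\<Delta>. finite \<Delta> \<and> \<Delta> \<subseteq> \<Gamma> \<and> \<Delta> \<turnstile>\<^sub>H a \<and> \<Delta> \<turnstile>\<^sub>H b"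
    if "\<exists>\<Delta>. finite \<Delta> \<and> \<Delta> \<subseteq> \<Gamma> \<and> \<Delta> \<turnstile>\<^sub>H a" "\<exists>\<Delta>. finite \<Delta> \<and> \<Delta> \<subseteq> \<Gamma> \<and> \<Delta> \<turnstile>\<^sub>H b" for a b
  proof -
    from that obtain A B where "finite A" "A \<subseteq> \<Gamma>" "A \<turnstile>\<^sub>H a" "finite B" "B \<subseteq> \<Gamma>" "B \<turnstile>\<^sub>H b" by blast
    then have "finite (A \<union> B)" "A \<union> B \<subseteq> \<Gamma>" "A \<union> B \<turnstile>\<^sub>H a" "A \<union> B \<turnstile>\<^sub>H b"
      by (auto intro: hilbert_mono)
    then show ?thesis by blast
  qed
  from assms show ?thesis
  proof (induction rule: hilbert.induct)
    case (premise a)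
    then show ?case by (intro exI[of _ "{a}"]) (simp add: hilbert.premise)
  next
    case (excluded_middle a)
    then show ?case by (blast intro: hilbert.excluded_middle)
  qed (((drule (1) two)?, elim exE conjE, intro exI conjI, assumption, assumption,
      rule hilbert.intros, assumption+); fail)+
qed

section \<open>Rules in disjunctive contexts and proof by cases\<close>

text \<open>A commutation followed by \<open>assoc\<close> rotates the three disjuncts cyclically;
  two rotations and a last commutation reverse \<open>assoc\<close>.\<close>

lemma assoc': "\<Gamma> \<turnstile>\<^sub>H (a \<^bold>\<or> b) \<^bold>\<or> c \<Longrightarrow> \<Gamma> \<turnstile>\<^sub>H a \<^bold>\<or> (b \<^bold>\<or> c)"
  by (rule commute, rule assoc, rule commute, rule assoc, rule commute)

text \<open>After reassociation the first \<open>a\<close> is weakened to a second copy of the whole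
  conclusion.\<close>

lemma contraction_context: "\<Gamma> \<turnstile>\<^sub>H (a \<^bold>\<or> a) \<^bold>\<or> c \<Longrightarrow> \<Gamma> \<turnstile>\<^sub>H a \<^bold>\<or> c"
proof -
  assume "\<Gamma> \<turnstile>\<^sub>H (a \<^bold>\<or> a) \<^bold>\<or> c"
  then have "\<Gamma> \<turnstile>\<^sub>H a \<^bold>\<or> (a \<^bold>\<or> c)" by (rule assoc')
  then have "\<Gamma> \<turnstile>\<^sub>H (a \<^bold>\<or> c) \<^bold>\<or> (a \<^bold>\<or> c)" by (rule disj_intro_left)
  then show ?thesis by (rule contraction)
qed

text \<open>Commutativity and associativity alone only move the outermost disjunction to another edge of a
  planar ternary tree, so they cannot be applied inside a context. The way out is to weaken to two
  copies of the desired conclusion and contract.\<close>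

lemma commute_context:
  assumes "\<Gamma> \<turnstile>\<^sub>H (a \<^bold>\<or> b) \<^bold>\<or> c"
  shows "\<Gamma> \<turnstile>\<^sub>H (b \<^bold>\<or> a) \<^bold>\<or> c"
proof -
  let ?D = "(b \<^bold>\<or> a) \<^bold>\<or> c"
  from assms have "\<Gamma> \<turnstile>\<^sub>H a \<^bold>\<or> (b \<^bold>\<or> c)" by (rule assoc')
  then have "\<Gamma> \<turnstile>\<^sub>H (b \<^bold>\<or> c) \<^bold>\<or> a" by (rule commute)
  then have "\<Gamma> \<turnstile>\<^sub>H b \<^bold>\<or> (c \<^bold>\<or> a)" by (rule assoc')
  then have "\<Gamma> \<turnstile>\<^sub>H (b \<^bold>\<or> a) \<^bold>\<or> (c \<^bold>\<or> a)" by (rule disj_intro_left)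
  then have "\<Gamma> \<turnstile>\<^sub>H ?D \<^bold>\<or> a" by (rule assoc)
  then have "\<Gamma> \<turnstile>\<^sub>H a \<^bold>\<or> ?D" by (rule commute)
  then have "\<Gamma> \<turnstile>\<^sub>H (b \<^bold>\<or> a) \<^bold>\<or> ?D" by (rule disj_intro_right)
  then have "\<Gamma> \<turnstile>\<^sub>H ?D \<^bold>\<or> ?D" by (rule disj_intro_left)
  then show ?thesis by (rule contraction)
qed

lemma assoc_context:
  assumes "\<Gamma> \<turnstile>\<^sub>H (a \<^bold>\<or> (b \<^bold>\<or> c)) \<^bold>\<or> d"
  shows "\<Gamma> \<turnstile>\<^sub>H ((a \<^bold>\<or> b) \<^bold>\<or> c) \<^bold>\<or> d"
proof -
  let ?D = "((a \<^bold>\<or> b) \<^bold>\<or> c) \<^bold>\<or> d"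
  from assms have "\<Gamma> \<turnstile>\<^sub>H a \<^bold>\<or> ((b \<^bold>\<or> c) \<^bold>\<or> d)" by (rule assoc')
  then have "\<Gamma> \<turnstile>\<^sub>H ((b \<^bold>\<or> c) \<^bold>\<or> d) \<^bold>\<or> a" by (rule commute)
  then have "\<Gamma> \<turnstile>\<^sub>H b \<^bold>\<or> (c \<^bold>\<or> (d \<^bold>\<or> a))" by (intro assoc')
  \<comment> \<open>Weakening \<open>b\<close> creates a new \<open>a\<close> in the right place,
    which lets the first \<open>?D\<close> be assembled. The original \<open>a\<close>, left over at
    the end, is weakened to the second \<open>?D\<close>.\<close>
  then have "\<Gamma> \<turnstile>\<^sub>H (a \<^bold>\<or> b) \<^bold>\<or> (c \<^bold>\<or> (d \<^bold>\<or> a))" by (rule disj_intro_right)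
  then have "\<Gamma> \<turnstile>\<^sub>H ?D \<^bold>\<or> a" by (rule assoc[OF assoc])
  then have "\<Gamma> \<turnstile>\<^sub>H a \<^bold>\<or> ?D" by (rule commute)
  then have "\<Gamma> \<turnstile>\<^sub>H ?D \<^bold>\<or> ?D" by (intro disj_intro_left)
  then show ?thesis by (rule contraction)
qed

text \<open>Most rules already carry a side disjunct \<open>c\<close>: reassociating moves
  \<open>d\<close> next to it, and the same rule applies with \<open>c \<or> d\<close> in place of
  \<open>c\<close>. Excluded middle and the structural rules have no such slot and are treated
  separately.\<close>

lemma hilbert_context:
  assumes "\<Delta> \<turnstile>\<^sub>H \<phi>" "\<And>a. a \<in> \<Delta> \<Longrightarrow> \<Gamma> \<turnstile>\<^sub>H a \<^bold>\<or> d"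
  shows "\<Gamma> \<turnstile>\<^sub>H \<phi> \<^bold>\<or> d"
  using assms(1)
proof (induction rule: hilbert.induct)
  case (premise a) then show ?case by (rule assms(2))
next
  case (excluded_middle a) show ?case by (rule weakening, rule hilbert.excluded_middle)
next
  case (contraction a) then show ?case by (blast intro: contraction_context)
next
  case (weakening a b) then show ?case by (blast intro: disj_intro_left)
next
  case (commute a b) then show ?case by (blast intro: commute_context)
next
  case (assoc a b c) then show ?case by (blast intro: assoc_context)
qed (rule assoc, (drule assoc')+, blast intro:
    hilbert.dneg_intro hilbert.dneg_elim hilbert.conj_intro
    hilbert.conj_elim hilbert.conj_elim_right_neg hilbert.conj_elim_left_neg
    hilbert.neg_conj_elim hilbert.conj_intro_left_glut hilbert.neg_conj_intro_left
    hilbert.conj_intro_right_glut hilbert.neg_conj_intro_right hilbert.disj_intro_left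
    hilbert.disj_intro_right hilbert.neg_disj_elim_right_neg hilbert.neg_disj_elim_left_neg
    hilbert.neg_disj_elim hilbert.neg_disj_intro_left_glut hilbert.neg_disj_intro_right_glut)+

text \<open>Carrying \<open>b\<close> along as side disjunct through the first derivation turns
  \<open>a \<or> b\<close> into \<open>\<phi> \<or> b\<close>; carrying \<open>\<phi>\<close>
  through the second turns \<open>b \<or> \<phi>\<close> into
  \<open>\<phi> \<or> \<phi>\<close>.\<close>

lemma hilbert_disj_elim:
  assumes "insert a \<Gamma> \<turnstile>\<^sub>H \<phi>" "insert b \<Gamma> \<turnstile>\<^sub>H \<phi>" "\<Gamma> \<turnstile>\<^sub>H a \<^bold>\<or> b"
  shows "\<Gamma> \<turnstile>\<^sub>H \<phi>"
proof -
  have "\<Gamma> \<turnstile>\<^sub>H \<phi> \<^bold>\<or> b"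
    using assms(1) by (rule hilbert_context) (use assms(3) in \<open>auto intro: weakening premise\<close>)
  then have "\<Gamma> \<turnstile>\<^sub>H b \<^bold>\<or> \<phi>" by (rule commute)
  then have "\<Gamma> \<turnstile>\<^sub>H \<phi> \<^bold>\<or> \<phi>"
    by (intro hilbert_context[OF assms(2)]) (auto intro: weakening premise)
  then show ?thesis by (rule contraction)
qed

section \<open>Maximal theories and completeness\<close>

text \<open>Zorn's lemma applies because of compactness: a proof from the union of a chain uses
  finitely many premises, which all lie in one member of the chain.\<close>

lemma maximal_unprovable:
  assumes "\<not> \<Gamma> \<turnstile>\<^sub>H \<phi>"
  obtains M where "\<Gamma> \<subseteq> M" "\<not> M \<turnstile>\<^sub>H \<phi>" "\<And>a. a \<notin> M \<Longrightarrow> insert a M \<turnstile>\<^sub>H \<phi>"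
proof -
  let ?S = "{M. \<Gamma> \<subseteq> M \<and> \<not> M \<turnstile>\<^sub>H \<phi>}"
  have "\<Union>C \<in> ?S" if C: "C \<noteq> {}" "subset.chain ?S C" for C
  proof -
    have "\<not> \<Union>C \<turnstile>\<^sub>H \<phi>"
    proof
      assume "\<Union>C \<turnstile>\<^sub>H \<phi>"
      then obtain \<Delta> where \<Delta>: "finite \<Delta>" "\<Delta> \<subseteq> \<Union>C" "\<Delta> \<turnstile>\<^sub>H \<phi>"
        using hilbert_compact by blast
      then obtain M where "M \<in> C" "\<Delta> \<subseteq> M"
        using C finite_subset_Union_chain by metis
      from \<Delta>(3) \<open>\<Delta> \<subseteq> M\<close> have "M \<turnstile>\<^sub>H \<phi>" by (rule hilbert_mono)
      moreover have "M \<in> ?S" using C(2) \<open>M \<in> C\<close> unfolding subset_chain_def by blast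
      ultimately show False by simp
    qed
    with C show ?thesis unfolding subset_chain_def by blast
  qed
  moreover have "?S \<noteq> {}" using assms by blast
  ultimately obtain M where M: "M \<in> ?S" "\<forall>X\<in>?S. M \<subseteq> X \<longrightarrow> X = M"
    using subset_Zorn_nonempty[of ?S] by blast
  show thesis
  proof (rule that)
    \<comment> \<open>A proper extension of \<open>M\<close> still contains \<open>\<Gamma>\<close>,
      so by maximality it can fail to lie in \<open>?S\<close> only by proving
      \<open>\<phi>\<close>.\<close>
    show "insert a M \<turnstile>\<^sub>H \<phi>" if "a \<notin> M" for a
      using that M by (metis (mono_tags, lifting) insertI1 mem_Collect_eq subset_insertI subset_trans)
  qed (use M in auto)
qed

lemma hilbert_complete:
  assumes "\<Gamma> \<turnstile>\<^sub>P\<^sub>W\<^sub>K \<phi>"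
  shows "\<Gamma> \<turnstile>\<^sub>H \<phi>"
proof (rule ccontr)
  assume "\<not> \<Gamma> \<turnstile>\<^sub>H \<phi>"
  then obtain M where M: "\<Gamma> \<subseteq> M" "\<not> M \<turnstile>\<^sub>H \<phi>" "\<And>a. a \<notin> M \<Longrightarrow> insert a M \<turnstile>\<^sub>H \<phi>"
    using maximal_unprovable by blast
  \<comment> \<open>If \<open>M\<close> proved some \<open>a\<close> outside \<open>M\<close>,
    cutting \<open>a\<close> from the proof of \<open>\<phi>\<close> would make \<open>M\<close>
    prove \<open>\<phi>\<close>.\<close>
  have closed: "M \<turnstile>\<^sub>H a \<longleftrightarrow> a \<in> M" for a
    using M(2,3) hilbert_cut[of "insert a M" \<phi> M] premise by blast
  have disj: "a \<^bold>\<or> b \<in> M \<longleftrightarrow> a \<in> M \<or> b \<in> M" for a b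
    using M(2,3) hilbert_disj_elim[of a M \<phi> b] weakening[of M a b]
      commute[OF weakening, of M b a] closed by blast
  \<comment> \<open>Here and below the side disjunct is instantiated by \<open>\<phi>\<close>. As
    \<open>\<phi>\<close> is not in \<open>M\<close>, primeness lets it be dropped, so the rules act
    on membership in \<open>M\<close> as if they had no context.\<close>
  have mem: "a \<in> M \<or> \<^bold>\<not> a \<in> M" "\<^bold>\<not> \<^bold>\<not> a \<in> M \<longleftrightarrow> a \<in> M" for a
    using M(2) excluded_middle[of M a] dneg_intro[of M a \<phi>] dneg_elim[of M a \<phi>]
    unfolding closed disj by blast+
  define v where "v a = (if a \<notin> M then F else if \<^bold>\<not> a \<in> M then U else T)" for a
  have "v (\<^bold>\<not> a) = neg_tv (v a)" for a
    using mem[of a] by (auto simp: v_def neg_tv_def of_bool_tv_def)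
  moreover have "v (a \<^bold>\<and> b) = conj_tv (v a) (v b)" for a b
  proof -
    \<comment> \<open>If an argument is \<open>U\<close>, the glut and negation introduction rules
      put the conjunction and its negation into \<open>M\<close>. For classical arguments,
      \<open>conj_elim\<close>, \<open>conj_elim_right_neg\<close> and
      \<open>conj_elim_left_neg\<close> exclude the conjunction from \<open>M\<close> in the rows
      FF, FT and TF; \<open>neg_conj_elim\<close> excludes its negation in the row TT.\<close>
    note rules = conj_intro[of M a \<phi> b] conj_elim[of M a b \<phi>] conj_elim_right_neg[of M a b \<phi>]
      conj_elim_left_neg[of M a b \<phi>] neg_conj_elim[of M a b \<phi>] conj_intro_left_glut[of M a \<phi> b]
      neg_conj_intro_left[of M a \<phi> b] conj_intro_right_glut[of M b \<phi> a]
      neg_conj_intro_right[of M b \<phi> a]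
    show ?thesis using rules M(2) mem[of a] mem[of b] mem[of "a \<^bold>\<and> b"]
      unfolding closed disj v_def conj_tv_def of_bool_tv_def by auto
  qed
  moreover have "v (a \<^bold>\<or> b) = disj_tv (v a) (v b)" for a b
  proof -
    \<comment> \<open>Primeness decides the disjunction itself. The three eliminations keep its
      negation out of \<open>M\<close> in the rows FT, TF and TT, and the glut rules put it in when
      an argument is \<open>U\<close>.\<close>
    note rules = neg_disj_elim_right_neg[of M a b \<phi>] neg_disj_elim_left_neg[of M a b \<phi>]
      neg_disj_elim[of M a b \<phi>] neg_disj_intro_left_glut[of M a \<phi> b]
      neg_disj_intro_right_glut[of M b \<phi> a]
    show ?thesis using rules M(2) mem[of a] mem[of b] mem[of "a \<^bold>\<or> b"]
      unfolding closed disj v_def disj_tv_def of_bool_tv_def by auto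
  qed
  ultimately have "valuation v" by (simp add: valuation_def)
  moreover have "v ` \<Gamma> \<subseteq> {U, T}" "v \<phi> = F"
    using M(1,2) closed by (auto simp: v_def)
  ultimately show False using assms unfolding pwk_def by blast
qed

theorem theorem6:
  fixes \<Gamma> :: "fm set" and \<phi> :: fm
  shows "derives R'_PWK \<Gamma> \<phi> \<longleftrightarrow> \<Gamma> \<turnstile>\<^sub>P\<^sub>W\<^sub>K \<phi>"
  using derives_iff_hilbert hilbert_sound hilbert_complete by blast

end
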